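(* Let $G=(V,E)$ be a locally finite, connected weighted graph with uniformly positive measure and symmetric, uniformly bounded weights (precise conditions in the context). Let $a:V\to[0,+\infty)$ be a function such that (i) the set $\Omega=\{x\in V: a(x)=0\}$ is a non-empty, connected and bounded domain in $V$, and (ii) there exists a vertex $x_0\in V$ such that $a(x)\to+\infty$ as $d(x,x_0)\to+\infty$. Let $p>2$. Then for any sequence $\lambda_k\to\infty$ (with $\lambda_k>1$) and corresponding ground state solutions $u_{\lambda_k}$ of $$\Delta^2u-\Delta u+(\lambda_k a+1)u=|u|^{p-2}u\quad\text{on }V,$$ up to a subsequence, $u_{\lambda_k}$ converges in $W^{2,2}(V)$ to a ground state solution of $$\Delta^2u-\Delta u+u=|u|^{p-2}u\ \text{ in }\Omega,\qquad u=0\ \text{ on }\partial\Omega.$$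
   Context: Graph. $G=(V,E)$ is a graph with vertex set $V$ and edge set $E$; $y\sim x$ means $xy\in E$. It is assumed that: each vertex has finitely many neighbours (locally finite); any two vertices can be joined by finitely many edges (connected); there is a measure $\mu:V\to(0,\infty)$ and a constant $\mu_{\min}>0$ with $\mu(x)\ge\mu_{\min}$ for all $x\in V$; each edge $xy$ has a positive weight $\omega_{xy}=\omega_{yx}$, and there is a constant $C$ with $\sum_{y\sim x}\omega_{xy}<C$ for all $x\in V$. $d(x,y)$ is the minimal number of edges connecting $x$ and $y$. A subset $\Omega\subset V$ is a bounded domain if $d(x,y)$ is uniformly bounded for $x,y\in\Omega$ (so $\Omega$ is finite). Its boundary is $\partial\Omega=\{y\in V\setminus\Omega:\exists x\in\Omega,\ xy\in E\}$. Operators. For $u,v:V\to\mathbb R$: $\Delta u(x)=\frac1{\mu(x)}\sum_{y\sim x}\omega_{xy}(u(y)-u(x))$; $\nabla u\nabla v(x)=\frac1{2\mu(x)}\sum_{y\sim x}\omega_{xy}(u(y)-u(x))(v(y)-v(x))$; $|\nabla u|^2=\nabla u\nabla u$; $\int_A u\,d\mu=\sum_{x\in A}\mu(x)u(x)$ for $A\subset V$. $C_c(V)$ is the set of finitely supported functions $V\to\mathbb R$. $\Delta^2u$ is defined distributionally by $\int_V(\Delta^2u)\phi\,d\mu=\int_V\Delta u\Delta\phi\,d\mu$ for all $\phi\in C_c(V)$. Problem on $V$. $W^{2,2}(V)$ is the completion of $C_c(V)$ under $\|u\|_{W^{2,2}(V)}=\left(\int_V(|\Delta u|^2+|\nabla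 u|^2+u^2)d\mu\right)^{1/2}$. For $\lambda>1$, $E_\lambda=\{u\in W^{2,2}(V):\int_V\lambda a u^2d\mu<+\infty\}$ with norm $\|u\|_{E_\lambda}=\left(\int_V(|\Delta u|^2+|\nabla u|^2+(\lambda a+1)u^2)d\mu\right)^{1/2}$. $J_\lambda(u)=\frac12\|u\|_{E_\lambda}^2-\frac1p\int_V|u|^pd\mu$ is a $C^1$ functional on $E_\lambda$ with $J_\lambda'(u)v=\int_V(\Delta u\Delta v+\nabla u\nabla v+(\lambda a+1)uv)d\mu-\int_V|u|^{p-2}uv\,d\mu$; $\mathcal N_\lambda=\{u\in E_\lambda\setminus\{0\}:J_\lambda'(u)u=0\}$; $m_\lambda=\inf_{\mathcal N_\lambda}J_\lambda$. A ground state solution of the equation on $V$ is a $u_\lambda\in\mathcal N_\lambda$ with $J_\lambda(u_\lambda)=m_\lambda$ which is a critical point of $J_\lambda$ (i.e. $J_\lambda'(u_\lambda)\phi=0$ for all $\phi\in E_\lambda$). Problem on $\Omega$. $W^{2,2}(\Omega)$ is the set of functions $u:V\to\mathbb R$ under the norm $\left(\int_{\Omega\cup\partial\Omega}(|\Delta u|^2+|\nabla u|^2)d\mu+\int_\Omega u^2d\mu\right)^{1/2}$. $W^{1,2}_0(\Omega)$ is the completion of $C_c(\Omega)$ under $\left(\int_{\Omega\cup\partial\Omega}|\nabla u|^2d\mu+\int_\Omega u^2d\mu\right)^{1/2}$, where $C_c(\Omega)$ is the set of functions $u$ with support in $\Omega$ and $u=0$ on $\partial\Omega$. $H(\Omega)=W^{2,2}(\Omega)\cap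 W^{1,2}_0(\Omega)$; its elements are regarded as functions on $V$ vanishing outside $\Omega$. On $H(\Omega)$, $J_\Omega(u)=\frac12\int_{\Omega\cup\partial\Omega}(|\Delta u|^2+|\nabla u|^2)d\mu+\frac12\int_\Omega u^2d\mu-\frac1p\int_\Omega|u|^pd\mu$; $\mathcal N_\Omega=\{u\in H(\Omega)\setminus\{0\}:J_\Omega'(u)u=0\}$; $m_\Omega=\inf_{\mathcal N_\Omega}J_\Omega$. A ground state solution of the problem on $\Omega$ is a $u_0\in\mathcal N_\Omega$ with $J_\Omega(u_0)=m_\Omega$ which is a critical point of $J_\Omega$, i.e. a weak solution: $\int_{\Omega\cup\partial\Omega}(\Delta u_0\Delta\phi+\nabla u_0\nabla\phi)d\mu+\int_\Omega u_0\phi\,d\mu=\int_\Omega|u_0|^{p-2}u_0\phi\,d\mu$ for all $\phi\in H(\Omega)$. *)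

theory Defs
  imports "HOL-Analysis.Analysis"
begin

section \<open>Weighted graphs\<close>

text \<open>The vertex set \<open>V\<close> is the whole type \<open>'v\<close>. The field \<open>weight G\<close> is only ever evaluated on
  edges. Loops are not excluded; they contribute nothing to the operators below.\<close>

record 'v wgraph =
  adj :: "'v \<Rightarrow> 'v \<Rightarrow> bool"
  weight :: "'v \<Rightarrow> 'v \<Rightarrow> real"
  vmeas :: "'v \<Rightarrow> real"

definition nbrs :: "'v wgraph \<Rightarrow> 'v \<Rightarrow> 'v set" where
  "nbrs G x = {y. adj G x y}"

locale weighted_graph =
  fixes G :: "'v wgraph"
  assumes adj_sym: "adj G x y \<Longrightarrow> adj G y x"
    and locally_finite: "finite (nbrs G x)"
    and graph_connected: "(adj G)\<^sup>*\<^sup>* x y"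
    and vmeas_bounded_below: "\<exists>mu_min>0. \<forall>x. vmeas G x \<ge> mu_min"
    and weight_pos: "adj G x y \<Longrightarrow> weight G x y > 0"
    and weight_sym: "adj G x y \<Longrightarrow> weight G x y = weight G y x"
    and weight_bounded: "\<exists>C. \<forall>x. (\<Sum>y\<in>nbrs G x. weight G x y) < C"

definition gdist :: "'v wgraph \<Rightarrow> 'v \<Rightarrow> 'v \<Rightarrow> nat" where
  "gdist G x y = (LEAST n. (adj G ^^ n) x y)"

definition bounded_domain :: "'v wgraph \<Rightarrow> 'v set \<Rightarrow> bool" where
  "bounded_domain G \<Omega> \<longleftrightarrow> (\<exists>D. \<forall>x\<in>\<Omega>. \<forall>y\<in>\<Omega>. gdist G x y \<le> D)"

definition connected_domain :: "'v wgraph \<Rightarrow> 'v set \<Rightarrow> bool" where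
  "connected_domain G \<Omega> \<longleftrightarrow>
     (\<forall>x\<in>\<Omega>. \<forall>y\<in>\<Omega>. (\<lambda>s t. adj G s t \<and> s \<in> \<Omega> \<and> t \<in> \<Omega>)\<^sup>*\<^sup>* x y)"

definition bdry :: "'v wgraph \<Rightarrow> 'v set \<Rightarrow> 'v set" where
  "bdry G \<Omega> = {y. y \<notin> \<Omega> \<and> (\<exists>x\<in>\<Omega>. adj G x y)}"

section \<open>Operators and integration\<close>

definition laplace :: "'v wgraph \<Rightarrow> ('v \<Rightarrow> real) \<Rightarrow> 'v \<Rightarrow> real" where
  "laplace G u x = (\<Sum>y\<in>nbrs G x. weight G x y * (u y - u x)) / vmeas G x"

definition grad_dot :: "'v wgraph \<Rightarrow> ('v \<Rightarrow> real) \<Rightarrow> ('v \<Rightarrow> real) \<Rightarrow> 'v \<Rightarrow> real" where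
  "grad_dot G u v x =
     (\<Sum>y\<in>nbrs G x. weight G x y * (u y - u x) * (v y - v x)) / (2 * vmeas G x)"

abbreviation grad_sq :: "'v wgraph \<Rightarrow> ('v \<Rightarrow> real) \<Rightarrow> 'v \<Rightarrow> real" where
  "grad_sq G u \<equiv> grad_dot G u u"

text \<open>The unconditional sum; by the library convention its value is 0 if the family is not summable.\<close>

definition integ :: "'v wgraph \<Rightarrow> 'v set \<Rightarrow> ('v \<Rightarrow> real) \<Rightarrow> real" where
  "integ G A f = (\<Sum>\<^sub>\<infinity>x\<in>A. vmeas G x * f x)"

definition integ_finite :: "'v wgraph \<Rightarrow> 'v set \<Rightarrow> ('v \<Rightarrow> real) \<Rightarrow> bool" where
  "integ_finite G A f \<longleftrightarrow> (\<lambda>x. vmeas G x * f x) summable_on A"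

section \<open>Completions\<close>

text \<open>The completion of a space \<open>C\<close> of functions on \<open>V\<close> under a norm \<open>N\<close>, realised as a space of
  functions: the class of an \<open>N\<close>-Cauchy sequence is represented by its pointwise limit. This is the
  abstract completion for both norms to which it is applied: since the vertex measure is bounded
  below, these norms control the point values (functions supported in \<open>\<Omega>\<close> vanish elsewhere), and by
  Fatou's lemma an \<open>N\<close>-Cauchy sequence with pointwise limit 0 is \<open>N\<close>-null. The norm of the limit
  function is then again given by the formula for \<open>N\<close>.\<close>

definition fun_completion ::
  "(('v \<Rightarrow> real) \<Rightarrow> real) \<Rightarrow> ('v \<Rightarrow> real) set \<Rightarrow> ('v \<Rightarrow> real) set" where
  "fun_completion N C = {u. \<exists>\<phi>. (\<forall>n. \<phi> n \<in> C) \<and>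
     (\<forall>e>0. \<exists>M::nat. \<forall>m\<ge>M. \<forall>n\<ge>M. N (\<lambda>x. \<phi> m x - \<phi> n x) < e) \<and>
     (\<forall>x. (\<lambda>n. \<phi> n x) \<longlonglongrightarrow> u x)}"

section \<open>The problem on \<open>V\<close>\<close>

definition Cc :: "('v \<Rightarrow> real) set" where
  "Cc = {u. finite {x. u x \<noteq> 0}}"

definition norm_W22 :: "'v wgraph \<Rightarrow> ('v \<Rightarrow> real) \<Rightarrow> real" where
  "norm_W22 G u = sqrt (integ G UNIV (\<lambda>x. (laplace G u x)\<^sup>2 + grad_sq G u x + (u x)\<^sup>2))"

definition W22 :: "'v wgraph \<Rightarrow> ('v \<Rightarrow> real) set" where
  "W22 G = fun_completion (norm_W22 G) Cc"

definition E_space :: "'v wgraph \<Rightarrow> ('v \<Rightarrow> real) \<Rightarrow> real \<Rightarrow> ('v \<Rightarrow> real) set" where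
  "E_space G a l = {u \<in> W22 G. integ_finite G UNIV (\<lambda>x. l * a x * (u x)\<^sup>2)}"

definition norm_E :: "'v wgraph \<Rightarrow> ('v \<Rightarrow> real) \<Rightarrow> real \<Rightarrow> ('v \<Rightarrow> real) \<Rightarrow> real" where
  "norm_E G a l u =
     sqrt (integ G UNIV (\<lambda>x. (laplace G u x)\<^sup>2 + grad_sq G u x + (l * a x + 1) * (u x)\<^sup>2))"

definition J :: "'v wgraph \<Rightarrow> ('v \<Rightarrow> real) \<Rightarrow> real \<Rightarrow> real \<Rightarrow> ('v \<Rightarrow> real) \<Rightarrow> real" where
  "J G a p l u = (norm_E G a l u)\<^sup>2 / 2 - integ G UNIV (\<lambda>x. \<bar>u x\<bar> powr p) / p"

text \<open>\<open>dJ G a p l u v\<close> is the derivative of the functional at \<open>u\<close> in direction \<open>v\<close>.\<close>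

definition dJ ::
  "'v wgraph \<Rightarrow> ('v \<Rightarrow> real) \<Rightarrow> real \<Rightarrow> real \<Rightarrow> ('v \<Rightarrow> real) \<Rightarrow> ('v \<Rightarrow> real) \<Rightarrow> real" where
  "dJ G a p l u v =
     integ G UNIV (\<lambda>x. laplace G u x * laplace G v x + grad_dot G u v x
                        + (l * a x + 1) * u x * v x)
     - integ G UNIV (\<lambda>x. \<bar>u x\<bar> powr (p - 2) * u x * v x)"

definition Nehari :: "'v wgraph \<Rightarrow> ('v \<Rightarrow> real) \<Rightarrow> real \<Rightarrow> real \<Rightarrow> ('v \<Rightarrow> real) set" where
  "Nehari G a p l = {u \<in> E_space G a l - {\<lambda>_. 0}. dJ G a p l u u = 0}"

definition ground_level :: "'v wgraph \<Rightarrow> ('v \<Rightarrow> real) \<Rightarrow> real \<Rightarrow> real \<Rightarrow> real" where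
  "ground_level G a p l = (INF u\<in>Nehari G a p l. J G a p l u)"

definition ground_state ::
  "'v wgraph \<Rightarrow> ('v \<Rightarrow> real) \<Rightarrow> real \<Rightarrow> real \<Rightarrow> ('v \<Rightarrow> real) \<Rightarrow> bool" where
  "ground_state G a p l u \<longleftrightarrow>
     u \<in> Nehari G a p l \<and> J G a p l u = ground_level G a p l \<and>
     (\<forall>\<phi>\<in>E_space G a l. dJ G a p l u \<phi> = 0)"

section \<open>The problem on \<open>\<Omega>\<close>\<close>

definition W22_dom :: "'v wgraph \<Rightarrow> 'v set \<Rightarrow> ('v \<Rightarrow> real) set" where
  "W22_dom G \<Omega> = {u. integ_finite G (\<Omega> \<union> bdry G \<Omega>) (\<lambda>x. (laplace G u x)\<^sup>2 + grad_sq G u x) \<and>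
                      integ_finite G \<Omega> (\<lambda>x. (u x)\<^sup>2)}"

definition Cc_dom :: "'v wgraph \<Rightarrow> 'v set \<Rightarrow> ('v \<Rightarrow> real) set" where
  "Cc_dom G \<Omega> = {u. {x. u x \<noteq> 0} \<subseteq> \<Omega> \<and> (\<forall>x\<in>bdry G \<Omega>. u x = 0)}"

definition norm_W12_dom :: "'v wgraph \<Rightarrow> 'v set \<Rightarrow> ('v \<Rightarrow> real) \<Rightarrow> real" where
  "norm_W12_dom G \<Omega> u =
     sqrt (integ G (\<Omega> \<union> bdry G \<Omega>) (grad_sq G u) + integ G \<Omega> (\<lambda>x. (u x)\<^sup>2))"

definition W12_0 :: "'v wgraph \<Rightarrow> 'v set \<Rightarrow> ('v \<Rightarrow> real) set" where
  "W12_0 G \<Omega> = fun_completion (norm_W12_dom G \<Omega>) (Cc_dom G \<Omega>)"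

text \<open>Elements of \<open>W12_0 G \<Omega>\<close>, being pointwise limits, vanish outside \<open>\<Omega>\<close>.\<close>

definition H_dom :: "'v wgraph \<Rightarrow> 'v set \<Rightarrow> ('v \<Rightarrow> real) set" where
  "H_dom G \<Omega> = W22_dom G \<Omega> \<inter> W12_0 G \<Omega>"

definition J_dom :: "'v wgraph \<Rightarrow> 'v set \<Rightarrow> real \<Rightarrow> ('v \<Rightarrow> real) \<Rightarrow> real" where
  "J_dom G \<Omega> p u =
     integ G (\<Omega> \<union> bdry G \<Omega>) (\<lambda>x. (laplace G u x)\<^sup>2 + grad_sq G u x) / 2
     + integ G \<Omega> (\<lambda>x. (u x)\<^sup>2) / 2 - integ G \<Omega> (\<lambda>x. \<bar>u x\<bar> powr p) / p"

definition dJ_dom :: "'v wgraph \<Rightarrow> 'v set \<Rightarrow> real \<Rightarrow> ('v \<Rightarrow> real) \<Rightarrow> ('v \<Rightarrow> real) \<Rightarrow> real" where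
  "dJ_dom G \<Omega> p u v =
     integ G (\<Omega> \<union> bdry G \<Omega>) (\<lambda>x. laplace G u x * laplace G v x + grad_dot G u v x)
     + integ G \<Omega> (\<lambda>x. u x * v x) - integ G \<Omega> (\<lambda>x. \<bar>u x\<bar> powr (p - 2) * u x * v x)"

definition Nehari_dom :: "'v wgraph \<Rightarrow> 'v set \<Rightarrow> real \<Rightarrow> ('v \<Rightarrow> real) set" where
  "Nehari_dom G \<Omega> p = {u \<in> H_dom G \<Omega> - {\<lambda>_. 0}. dJ_dom G \<Omega> p u u = 0}"

definition ground_level_dom :: "'v wgraph \<Rightarrow> 'v set \<Rightarrow> real \<Rightarrow> real" where
  "ground_level_dom G \<Omega> p = (INF u\<in>Nehari_dom G \<Omega> p. J_dom G \<Omega> p u)"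

definition ground_state_dom :: "'v wgraph \<Rightarrow> 'v set \<Rightarrow> real \<Rightarrow> ('v \<Rightarrow> real) \<Rightarrow> bool" where
  "ground_state_dom G \<Omega> p u \<longleftrightarrow>
     u \<in> Nehari_dom G \<Omega> p \<and> J_dom G \<Omega> p u = ground_level_dom G \<Omega> p \<and>
     (\<forall>\<phi>\<in>H_dom G \<Omega>. dJ_dom G \<Omega> p u \<phi> = 0)"

end

theory Submission
  imports Defs "HOL-Complex_Analysis.Great_Picard"
begin

text \<open>Competitors for the problem on \<open>\<Omega>\<close> are competitors for every \<open>\<lambda>\<close>, so the energies of the
  ground states \<open>u\<^sub>k\<close> are bounded by the level of \<open>\<Omega>\<close>, and on the Nehari manifold the energy controls
  the norm. The potential \<open>a\<close> tends to infinity and balls are finite, hence \<open>a \<ge> \<alpha> > 0\<close> off the finite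
  set \<open>\<Omega>\<close>, and the mass of \<open>u\<^sub>k\<close> there is \<open>O(1 / \<lambda>\<^sub>k)\<close>. So pointwise convergence of a subsequence on
  \<open>\<Omega>\<close> is already convergence in \<open>\<ell>\<^sup>2\<close>, which is convergence in \<open>W\<^sup>2\<^sup>,\<^sup>2\<close> because the Laplacian and
  the gradient are bounded on \<open>\<ell>\<^sup>2\<close>. The weak equation passes to the limit through finite sums.
  The limit is not zero: a Nehari function attains a value of modulus at least 1, as otherwise its
  \<open>p\<close>-th power integral would be smaller than its squared norm.\<close>

section \<open>Finite sums, supports and elementary power inequalities\<close>

lemma integ_eq_sum:
  assumes "finite A" "\<And>x. x \<notin> A \<Longrightarrow> f x = 0"
  shows "integ G UNIV f = (\<Sum>x\<in>A. vmeas G x * f x)"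
proof -
  have "integ G UNIV f = infsum (\<lambda>x. vmeas G x * f x) A"
    unfolding integ_def by (rule infsum_cong_neutral) (use assms in auto)
  then show ?thesis
    using assms(1) by simp
qed

lemma integ_finite_sum: "finite A \<Longrightarrow> integ G A f = (\<Sum>x\<in>A. vmeas G x * f x)"
  by (simp add: integ_def)

text \<open>Outside the given set \<open>v\<close> vanishes at \<open>x\<close> and at all its
  neighbours. The edges start at \<open>x\<close> to match \<open>nbrs\<close>;
  \<open>nbhd_bdry\<close> identifies the set with \<Omega> and its boundary by symmetry of
  \<open>adj\<close>.\<close>

lemma laplace_eq_0:
  assumes "{x. v x \<noteq> 0} \<subseteq> \<Omega>" "x \<notin> \<Omega> \<union> {x. \<exists>y\<in>\<Omega>. adj G x y}"
  shows "laplace G v x = 0"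
proof -
  have "v y = 0" if "y \<in> nbrs G x" for y
    using assms that by (auto simp: nbrs_def)
  moreover have "v x = 0"
    using assms by auto
  ultimately show ?thesis
    by (simp add: laplace_def)
qed

lemma grad_dot_eq_0:
  assumes "{x. v x \<noteq> 0} \<subseteq> \<Omega>" "x \<notin> \<Omega> \<union> {x. \<exists>y\<in>\<Omega>. adj G x y}"
  shows "grad_dot G u v x = 0"
proof -
  have "v y = 0" if "y \<in> nbrs G x" for y
    using assms that by (auto simp: nbrs_def)
  moreover have "v x = 0"
    using assms by auto
  ultimately show ?thesis
    by (simp add: grad_dot_def)
qed

lemma abs_powr_mult_self:
  fixes t :: real
  assumes "p > 2"
  shows "\<bar>t\<bar> powr (p - 2) * t * t = \<bar>t\<bar> powr p"
proof -
  have "t * t = \<bar>t\<bar> powr 2"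
    by (simp add: power2_eq_square)
  then show ?thesis
    unfolding mult.assoc by (simp only: powr_add [symmetric]) simp
qed

lemma abs_powr_less_square:
  fixes t :: real
  assumes "p > 2" "t \<noteq> 0" "\<bar>t\<bar> < 1"
  shows "\<bar>t\<bar> powr p < t\<^sup>2"
proof -
  have "\<bar>t\<bar> powr p < \<bar>t\<bar> powr 2"
    using assms by (intro powr_less_mono') auto
  then show ?thesis
    using assms by simp
qed

section \<open>Finiteness of balls and description of the function spaces\<close>

context weighted_graph
begin

lemma vmeas_pos: "vmeas G x > 0"
  using vmeas_bounded_below by (meson less_le_trans)

lemma vmeas_nonneg [simp]: "vmeas G x \<ge> 0"
  using vmeas_pos by (rule less_imp_le)

lemma finite_bdry:
  assumes "finite \<Omega>"
  shows "finite (bdry G \<Omega>)"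
proof (rule finite_subset)
  show "bdry G \<Omega> \<subseteq> (\<Union>x\<in>\<Omega>. nbrs G x)"
    by (auto simp: bdry_def nbrs_def)
qed (use assms locally_finite in auto)

lemma nbhd_bdry: "\<Omega> \<union> {x. \<exists>y\<in>\<Omega>. adj G x y} = \<Omega> \<union> bdry G \<Omega>"
  using adj_sym by (auto simp: bdry_def)

text \<open>Local finiteness leaves finitely many starting points of walks of each length ending at
  \<open>z\<close>; connectedness makes the \<open>LEAST\<close> in \<open>gdist\<close> the length
  of an actual walk.\<close>

lemma finite_ball: "finite {x. gdist G x z < n}"
proof -
  have walks: "finite {x. (adj G ^^ m) x z}" for m
  proof (induction m arbitrary: z)
    case (Suc m)
    have "{x. (adj G ^^ Suc m) x z} \<subseteq> (\<Union>y\<in>nbrs G z. {x. (adj G ^^ m) x y})"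
      using adj_sym by (auto simp: nbrs_def)
    then show ?case
      using Suc locally_finite by (meson finite_UN_I finite_subset)
  qed simp
  have "(adj G ^^ gdist G x z) x z" for x
    unfolding gdist_def using rtranclp_imp_relpowp [OF graph_connected] by (meson LeastI_ex)
  then have "{x. gdist G x z < n} \<subseteq> (\<Union>m<n. {x. (adj G ^^ m) x z})"
    by auto
  then show ?thesis
    using walks by (meson finite_UN_I finite_lessThan finite_subset)
qed

text \<open>Divergence at infinity confines a sublevel set to a ball. This yields both the
  finiteness of \<Omega> and a positive lower bound of \<open>a\<close> off \<Omega>.\<close>

lemma finite_sublevel:
  assumes "filterlim a at_top (filtercomap (\<lambda>x. gdist G x x0) at_top)"
  shows "finite {x. a x < (M::real)}"
proof -
  have "eventually (\<lambda>x. M \<le> a x) (filtercomap (\<lambda>x. gdist G x x0) at_top)"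
    using assms by (simp add: filterlim_at_top)
  then obtain n where "\<And>x. n \<le> gdist G x x0 \<Longrightarrow> M \<le> a x"
    unfolding eventually_filtercomap eventually_at_top_linorder by blast
  then have "{x. a x < M} \<subseteq> {x. gdist G x x0 < n}"
    by (force simp: not_le [symmetric])
  then show ?thesis
    using finite_ball finite_subset by blast
qed

lemma grad_sq_nonneg: "grad_sq G u x \<ge> 0"
  unfolding grad_dot_def mult.assoc
  by (intro divide_nonneg_nonneg sum_nonneg mult_nonneg_nonneg [OF _ zero_le_square])
     (use vmeas_pos [of x] weight_pos in \<open>auto simp: nbrs_def intro: less_imp_le\<close>)

text \<open>Pointwise limits keep the vanishing outside \<Omega>. Conversely a constant sequence
  represents the function, and integrability is automatic on finite sets.\<close>

lemma H_dom_eq: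
  assumes "finite \<Omega>"
  shows "H_dom G \<Omega> = {u. {x. u x \<noteq> 0} \<subseteq> \<Omega>}"
proof (intro set_eqI iffI)
  fix u assume "u \<in> H_dom G \<Omega>"
  then obtain \<phi> where \<phi>: "\<And>n. \<phi> n \<in> Cc_dom G \<Omega>" "\<And>x. (\<lambda>n. \<phi> n x) \<longlonglongrightarrow> u x"
    by (auto simp: H_dom_def W12_0_def fun_completion_def)
  have "u x = 0" if "x \<notin> \<Omega>" for x
  proof -
    have "\<phi> n x = 0" for n
      using \<phi>(1) [of n] that by (auto simp: Cc_dom_def)
    then show ?thesis
      using \<phi>(2) [of x] by (simp add: LIMSEQ_const_iff)
  qed
  then show "u \<in> {u. {x. u x \<noteq> 0} \<subseteq> \<Omega>}"
    by auto
next
  fix u :: "'v \<Rightarrow> real" assume u: "u \<in> {u. {x. u x \<noteq> 0} \<subseteq> \<Omega>}"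
  then have "u \<in> Cc_dom G \<Omega>"
    by (auto simp: Cc_dom_def bdry_def)
  moreover have "norm_W12_dom G \<Omega> (\<lambda>x. 0) = 0"
    by (simp add: norm_W12_dom_def integ_def grad_dot_def)
  ultimately have "u \<in> W12_0 G \<Omega>"
    unfolding W12_0_def fun_completion_def by (intro CollectI exI [of _ "\<lambda>n. u"]) auto
  moreover have "u \<in> W22_dom G \<Omega>"
    using assms finite_bdry [OF assms] by (simp add: W22_dom_def integ_finite_def)
  ultimately show "u \<in> H_dom G \<Omega>"
    by (simp add: H_dom_def)
qed

lemma Cc_subset_W22: "Cc \<subseteq> W22 G"
proof
  fix u :: "'v \<Rightarrow> real" assume "u \<in> Cc"
  moreover have "norm_W22 G (\<lambda>x. 0) = 0"
    by (simp add: norm_W22_def integ_def grad_dot_def laplace_def)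
  ultimately show "u \<in> W22 G"
    unfolding W22_def fun_completion_def by (intro CollectI exI [of _ "\<lambda>n. u"]) auto
qed

section \<open>Comparison of the functionals on V and on \<Omega>\<close>

text \<open>The derivative terms live on \<Omega> and its boundary, and the potential is zero
  wherever \<open>v\<close> is not. \<open>u\<close> stays arbitrary because ground states on V,
  which need not vanish off \<Omega>, are inserted for it.\<close>

lemma integ_form_eq_dom:
  assumes "finite \<Omega>" "\<And>x. x \<in> \<Omega> \<Longrightarrow> a x = 0" and supp: "{x. v x \<noteq> 0} \<subseteq> \<Omega>"
  shows "integ G UNIV (\<lambda>x. laplace G u x * laplace G v x + grad_dot G u v x + (l * a x + 1) * u x * v x)
    = integ G (\<Omega> \<union> bdry G \<Omega>) (\<lambda>x. laplace G u x * laplace G v x + grad_dot G u v x)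
      + integ G \<Omega> (\<lambda>x. u x * v x)"
proof -
  let ?U = "\<Omega> \<union> bdry G \<Omega>" and ?g = "\<lambda>x. laplace G u x * laplace G v x + grad_dot G u v x"
  have fin: "finite ?U"
    using assms(1) finite_bdry by simp
  have g0: "?g x = 0" if "x \<notin> ?U" for x
    using laplace_eq_0 [OF supp, of x G] grad_dot_eq_0 [OF supp, of x G u] that unfolding nbhd_bdry by simp
  have v0: "v x = 0" if "x \<notin> \<Omega>" for x
    using supp that by auto
  have "integ G UNIV (\<lambda>x. ?g x + (l * a x + 1) * u x * v x)
      = (\<Sum>x\<in>?U. vmeas G x * (?g x + (l * a x + 1) * u x * v x))"
    using fin g0 v0 by (intro integ_eq_sum) auto
  also have "\<dots> = integ G ?U ?g + (\<Sum>x\<in>?U. vmeas G x * ((l * a x + 1) * u x * v x))"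
    using fin by (simp add: integ_finite_sum distrib_left sum.distrib)
  also have "(\<Sum>x\<in>?U. vmeas G x * ((l * a x + 1) * u x * v x)) = (\<Sum>x\<in>\<Omega>. vmeas G x * (u x * v x))"
    using fin v0 assms(2) by (intro sum.mono_neutral_cong_right) auto
  finally show ?thesis
    using assms(1) by (simp add: integ_finite_sum)
qed

lemma dJ_eq_dJ_dom:
  assumes "finite \<Omega>" "\<And>x. x \<in> \<Omega> \<Longrightarrow> a x = 0" "{x. v x \<noteq> 0} \<subseteq> \<Omega>"
  shows "dJ G a p l u v = dJ_dom G \<Omega> p u v"
proof -
  have "integ G UNIV (\<lambda>x. \<bar>u x\<bar> powr (p - 2) * u x * v x)
      = integ G \<Omega> (\<lambda>x. \<bar>u x\<bar> powr (p - 2) * u x * v x)"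
    unfolding integ_finite_sum [OF assms(1)] using assms by (intro integ_eq_sum) auto
  then show ?thesis
    unfolding dJ_def dJ_dom_def by (simp only: integ_form_eq_dom [of \<Omega> a v u l, OF assms])
qed

text \<open>Squaring the root requires a nonnegative sum, and this holds for every \<open>u\<close>:
  a divergent sum of nonnegative terms has value 0 by convention.\<close>

lemma norm_E_squared:
  assumes "\<And>x. a x \<ge> 0" "l > 0"
  shows "(norm_E G a l u)\<^sup>2
    = integ G UNIV (\<lambda>x. (laplace G u x)\<^sup>2 + grad_sq G u x + (l * a x + 1) * (u x)\<^sup>2)"
proof -
  have "integ G UNIV (\<lambda>x. (laplace G u x)\<^sup>2 + grad_sq G u x + (l * a x + 1) * (u x)\<^sup>2) \<ge> 0"
    unfolding integ_def using vmeas_pos grad_sq_nonneg assms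
    by (intro infsum_nonneg mult_nonneg_nonneg add_nonneg_nonneg) (auto intro: less_imp_le)
  then show ?thesis
    by (simp add: norm_E_def)
qed

lemma J_eq_J_dom:
  assumes "finite \<Omega>" "\<And>x. x \<in> \<Omega> \<Longrightarrow> a x = 0" "{x. v x \<noteq> 0} \<subseteq> \<Omega>"
    and "\<And>x. a x \<ge> 0" "l > 0"
  shows "J G a p l v = J_dom G \<Omega> p v"
proof -
  have "integ G UNIV (\<lambda>x. \<bar>v x\<bar> powr p) = integ G \<Omega> (\<lambda>x. \<bar>v x\<bar> powr p)"
    unfolding integ_finite_sum [OF assms(1)] using assms by (intro integ_eq_sum) auto
  moreover have "(norm_E G a l v)\<^sup>2
      = integ G (\<Omega> \<union> bdry G \<Omega>) (\<lambda>x. (laplace G v x)\<^sup>2 + grad_sq G v x) + integ G \<Omega> (\<lambda>x. (v x)\<^sup>2)"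
    using integ_form_eq_dom [of \<Omega> a v v l, OF assms(1-3)] norm_E_squared [of a l v, OF assms(4,5)]
    by (simp add: power2_eq_square mult.assoc)
  ultimately show ?thesis
    by (simp add: J_def J_dom_def)
qed

text \<open>Testing with \<open>u\<close> itself equates the two integrals; eliminating the power
  integral leaves the factor 1/2 - 1/p, positive for p > 2, so energy bounds become norm
  bounds.\<close>

lemma Nehari_norm_E:
  assumes "\<And>x. a x \<ge> 0" "l > 0" "p > 2" "u \<in> Nehari G a p l"
  shows "integ G UNIV (\<lambda>x. \<bar>u x\<bar> powr p) = (norm_E G a l u)\<^sup>2"
    and "J G a p l u = (1 / 2 - 1 / p) * (norm_E G a l u)\<^sup>2"
proof -
  have "dJ G a p l u u = 0"
    using assms by (simp add: Nehari_def)
  then show *: "integ G UNIV (\<lambda>x. \<bar>u x\<bar> powr p) = (norm_E G a l u)\<^sup>2"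
    using norm_E_squared [of a l u, OF assms(1,2)] abs_powr_mult_self [OF \<open>p > 2\<close>]
    by (simp add: dJ_def power2_eq_square mult.assoc)
  show "J G a p l u = (1 / 2 - 1 / p) * (norm_E G a l u)\<^sup>2"
    unfolding J_def * using \<open>p > 2\<close> by (simp add: field_simps)
qed

text \<open>Here the quadratic part is eliminated instead. What remains is a finite sum of powers,
  which passes to the limit and is bounded by its counterpart on V.\<close>

lemma Nehari_dom_J_dom:
  assumes "finite \<Omega>" "p > 2" "u \<in> Nehari_dom G \<Omega> p"
  shows "J_dom G \<Omega> p u = (1 / 2 - 1 / p) * integ G \<Omega> (\<lambda>x. \<bar>u x\<bar> powr p)"
proof -
  have "dJ_dom G \<Omega> p u u = 0"
    using assms by (simp add: Nehari_dom_def)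
  then have *: "integ G (\<Omega> \<union> bdry G \<Omega>) (\<lambda>x. (laplace G u x)\<^sup>2 + grad_sq G u x)
      + integ G \<Omega> (\<lambda>x. (u x)\<^sup>2) = integ G \<Omega> (\<lambda>x. \<bar>u x\<bar> powr p)"
    using abs_powr_mult_self [OF \<open>p > 2\<close>] by (simp add: dJ_dom_def power2_eq_square mult.assoc)
  show ?thesis
    unfolding J_dom_def * [symmetric] add_divide_distrib [symmetric]
    using \<open>p > 2\<close> by (simp add: field_simps)
qed

lemma supported_in_E_space:
  assumes "finite \<Omega>" "\<And>x. x \<in> \<Omega> \<Longrightarrow> a x = 0" "{x. v x \<noteq> 0} \<subseteq> \<Omega>"
  shows "v \<in> E_space G a l"
proof -
  have "v \<in> W22 G"
    using Cc_subset_W22 assms(1,3) finite_subset by (auto simp: Cc_def)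
  moreover have "vmeas G x * (l * a x * (v x)\<^sup>2) = 0" for x
    using assms(2,3) by (cases "x \<in> \<Omega>") auto
  then have "(\<lambda>x. vmeas G x * (l * a x * (v x)\<^sup>2)) summable_on UNIV"
    by (rule summable_on_0)
  ultimately show ?thesis
    by (simp add: E_space_def integ_finite_def)
qed

lemma Nehari_dom_subset_Nehari:
  assumes "finite \<Omega>" "\<And>x. x \<in> \<Omega> \<Longrightarrow> a x = 0"
  shows "Nehari_dom G \<Omega> p \<subseteq> Nehari G a p l"
proof
  fix v assume v: "v \<in> Nehari_dom G \<Omega> p"
  then have supp: "{x. v x \<noteq> 0} \<subseteq> \<Omega>"
    using H_dom_eq [OF assms(1)] by (auto simp: Nehari_dom_def)
  then have "v \<in> E_space G a l"
    by (intro supported_in_E_space [of \<Omega> a] assms)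
  moreover have "dJ G a p l v v = 0"
    using v dJ_eq_dJ_dom [OF assms supp] by (simp add: Nehari_dom_def)
  ultimately show "v \<in> Nehari G a p l"
    using v by (auto simp: Nehari_def Nehari_dom_def)
qed

text \<open>A suitable multiple of a point mass works, since the quadratic and the power term scale
  with different exponents.\<close>

lemma Nehari_dom_nonempty:
  assumes "finite \<Omega>" "\<Omega> \<noteq> {}" "p > 2"
  shows "Nehari_dom G \<Omega> p \<noteq> {}"
proof -
  obtain z where z: "z \<in> \<Omega>"
    using assms(2) by auto
  define \<delta> :: "'v \<Rightarrow> real" where "\<delta> = (\<lambda>x. if x = z then 1 else 0)"
  \<comment> \<open>\<open>A\<close> is the quadratic form at \<open>\<delta>\<close>; the next
    \<open>t\<close> is chosen to solve \<open>t powr (p - 2) * vmeas G z = A\<close>.\<close>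
  define A where "A = integ G (\<Omega> \<union> bdry G \<Omega>) (\<lambda>x. (laplace G \<delta> x)\<^sup>2 + grad_sq G \<delta> x) + vmeas G z"
  define t where "t = (A / vmeas G z) powr (1 / (p - 2))"
  have "integ G (\<Omega> \<union> bdry G \<Omega>) (\<lambda>x. (laplace G \<delta> x)\<^sup>2 + grad_sq G \<delta> x) \<ge> 0"
    unfolding integ_def using vmeas_pos grad_sq_nonneg
    by (intro infsum_nonneg mult_nonneg_nonneg add_nonneg_nonneg) (auto intro: less_imp_le)
  then have A: "A > 0"
    using vmeas_pos [of z] by (simp add: A_def)
  then have t: "t > 0" "t powr (p - 2) * vmeas G z = A"
    using vmeas_pos [of z] assms(3) by (auto simp: t_def powr_powr)
  define v where "v = (\<lambda>x. t * \<delta> x)"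
  have lap: "laplace G v x = t * laplace G \<delta> x" for x
    by (simp add: laplace_def v_def sum_distrib_left algebra_simps)
  have grad: "grad_sq G v x = t * t * grad_sq G \<delta> x" for x
    by (simp add: grad_dot_def v_def sum_distrib_left algebra_simps)
  have "dJ_dom G \<Omega> p v v = t * t * A - t * t * (t powr (p - 2) * vmeas G z)"
  proof -
    have fin: "finite (\<Omega> \<union> bdry G \<Omega>)"
      using assms(1) finite_bdry by simp
    have "integ G (\<Omega> \<union> bdry G \<Omega>) (\<lambda>x. laplace G v x * laplace G v x + grad_dot G v v x)
        = t * t * integ G (\<Omega> \<union> bdry G \<Omega>) (\<lambda>x. (laplace G \<delta> x)\<^sup>2 + grad_sq G \<delta> x)"
      unfolding integ_finite_sum [OF fin] sum_distrib_left lap grad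
      by (simp add: algebra_simps power2_eq_square)
    moreover have "integ G \<Omega> (\<lambda>x. v x * v x) = (\<Sum>x\<in>\<Omega>. if x = z then t * t * vmeas G z else 0)"
      unfolding integ_finite_sum [OF assms(1)] by (intro sum.cong) (auto simp: v_def \<delta>_def)
    moreover have "integ G \<Omega> (\<lambda>x. \<bar>v x\<bar> powr (p - 2) * v x * v x)
        = (\<Sum>x\<in>\<Omega>. if x = z then t * t * (t powr (p - 2) * vmeas G z) else 0)"
      unfolding integ_finite_sum [OF assms(1)] using t by (intro sum.cong) (auto simp: v_def \<delta>_def)
    ultimately show ?thesis
      using assms(1) z by (simp add: dJ_dom_def A_def sum.delta algebra_simps)
  qed
  then have "dJ_dom G \<Omega> p v v = 0"
    using t by simp
  moreover have "v z \<noteq> 0"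
    using t by (simp add: v_def \<delta>_def)
  then have "v \<noteq> (\<lambda>_. 0)"
    by auto
  moreover have "v \<in> H_dom G \<Omega>"
    unfolding H_dom_eq [OF assms(1)] using z by (auto simp: v_def \<delta>_def)
  ultimately show ?thesis
    by (auto simp: Nehari_dom_def)
qed

section \<open>Boundedness of the Laplacian and the gradient on square-summable functions\<close>

text \<open>Cauchy-Schwarz with each weight split into two square roots: one factor is the total
  weight at \<open>x\<close>, the other is \<open>2 * vmeas G x * grad_sq G u x\<close>.\<close>

lemma laplace_sq_le_grad_sq:
  assumes "\<And>x. m \<le> vmeas G x" "m > 0" "(\<Sum>y\<in>nbrs G x. weight G x y) \<le> C"
  shows "(laplace G u x)\<^sup>2 \<le> 2 * C / m * grad_sq G u x"
proof -
  define S where "S = (\<Sum>y\<in>nbrs G x. weight G x y * (u y - u x)\<^sup>2)"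
  have w: "weight G x y > 0" if "y \<in> nbrs G x" for y
    using that weight_pos by (simp add: nbrs_def)
  have "(\<Sum>y\<in>nbrs G x. weight G x y * (u y - u x))\<^sup>2
      = (\<Sum>y\<in>nbrs G x. sqrt (weight G x y) * (sqrt (weight G x y) * (u y - u x)))\<^sup>2"
    using w by (intro arg_cong [where f = "\<lambda>s. s\<^sup>2"] sum.cong) (auto simp: mult.assoc [symmetric] less_imp_le)
  also have "\<dots> \<le> (\<Sum>y\<in>nbrs G x. (sqrt (weight G x y))\<^sup>2) * (\<Sum>y\<in>nbrs G x. (sqrt (weight G x y) * (u y - u x))\<^sup>2)"
    by (rule Cauchy_Schwarz_ineq_sum)
  also have "\<dots> = (\<Sum>y\<in>nbrs G x. weight G x y) * S"
    unfolding S_def using w by (intro arg_cong2 [where f = "(*)"] sum.cong) (auto simp: power_mult_distrib less_imp_le)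
  also have "\<dots> \<le> C * S"
    using assms(3) w unfolding S_def by (intro mult_right_mono sum_nonneg) (auto simp: less_imp_le)
  finally have *: "(laplace G u x)\<^sup>2 \<le> C * S / (vmeas G x)\<^sup>2"
    unfolding laplace_def power_divide using vmeas_pos [of x] by (intro divide_right_mono) auto
  have S: "S = 2 * vmeas G x * grad_sq G u x"
    using vmeas_pos [of x] by (simp add: S_def grad_dot_def power2_eq_square mult.assoc)
  have "0 \<le> (\<Sum>y\<in>nbrs G x. weight G x y)"
    using w by (intro sum_nonneg) (auto intro: less_imp_le)
  then have C: "C \<ge> 0"
    using assms(3) by simp
  \<comment> \<open>One factor of the measure cancels against \<open>S\<close>; the other is
    replaced by its lower bound \<open>m\<close>.\<close>
  have "C * S / (vmeas G x)\<^sup>2 = 2 * C * grad_sq G u x / vmeas G x"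
    using vmeas_pos [of x] unfolding S by (simp add: power2_eq_square)
  also have "\<dots> \<le> 2 * C * grad_sq G u x / m"
    using assms(1) [of x] \<open>m > 0\<close> C grad_sq_nonneg [of u x] by (intro divide_left_mono mult_nonneg_nonneg mult_pos_pos) auto
  finally show ?thesis
    using * by simp
qed

text \<open>Each squared difference is split between the endpoints of its edge, so a vertex is
  charged at most \<open>C\<close> as base point and at most \<open>C\<close> as neighbour. Finite
  sums are used because summability of the gradient is only derived from this bound.\<close>

lemma sum_grad_sq_le:
  assumes C: "\<And>x. (\<Sum>y\<in>nbrs G x. weight G x y) \<le> C" and "C \<ge> 0" and "finite F"
    and summ: "(\<lambda>x. (w x)\<^sup>2) summable_on UNIV"
  shows "(\<Sum>x\<in>F. vmeas G x * grad_sq G w x) \<le> 2 * C * (\<Sum>\<^sub>\<infinity>x. (w x)\<^sup>2)"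
proof -
  \<comment> \<open>\<open>B\<close> contains all vertices reached from \<open>F\<close>, so the
    double sum over edges can be exchanged between two finite ranges.\<close>
  define B where "B = F \<union> (\<Union>x\<in>F. nbrs G x)"
  have fB: "finite B"
    using assms(3) locally_finite by (simp add: B_def)
  have wt: "weight G x y > 0" if "y \<in> nbrs G x" for x y
    using that weight_pos by (simp add: nbrs_def)
  have "vmeas G x * grad_sq G w x \<le> C * (w x)\<^sup>2 + (\<Sum>y\<in>nbrs G x. weight G x y * (w y)\<^sup>2)" for x
  proof -
    have "vmeas G x * grad_sq G w x = (\<Sum>y\<in>nbrs G x. weight G x y * ((w y - w x)\<^sup>2 / 2))"
      using vmeas_pos [of x]
      by (simp add: grad_dot_def power2_eq_square mult.assoc sum_divide_distrib sum_distrib_left)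
    also have "\<dots> \<le> (\<Sum>y\<in>nbrs G x. weight G x y * ((w x)\<^sup>2 + (w y)\<^sup>2))"
    proof (intro sum_mono mult_left_mono)
      fix y
      have "0 \<le> (w y + w x)\<^sup>2"
        by simp
      then show "(w y - w x)\<^sup>2 / 2 \<le> (w x)\<^sup>2 + (w y)\<^sup>2"
        by (simp add: power2_eq_square algebra_simps)
    qed (use wt in \<open>auto intro: less_imp_le\<close>)
    also have "\<dots> = (\<Sum>y\<in>nbrs G x. weight G x y) * (w x)\<^sup>2 + (\<Sum>y\<in>nbrs G x. weight G x y * (w y)\<^sup>2)"
      by (simp add: distrib_left sum.distrib sum_distrib_right)
    finally show ?thesis
      using mult_right_mono [OF C [of x], of "(w x)\<^sup>2"] by simp
  qed
  then have "(\<Sum>x\<in>F. vmeas G x * grad_sq G w x)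
      \<le> (\<Sum>x\<in>F. C * (w x)\<^sup>2 + (\<Sum>y\<in>nbrs G x. weight G x y * (w y)\<^sup>2))"
    by (intro sum_mono)
  also have "\<dots> = C * (\<Sum>x\<in>F. (w x)\<^sup>2) + (\<Sum>x\<in>F. \<Sum>y\<in>nbrs G x. weight G x y * (w y)\<^sup>2)"
    by (simp add: sum.distrib sum_distrib_left)
  also have "(\<Sum>x\<in>F. \<Sum>y\<in>nbrs G x. weight G x y * (w y)\<^sup>2)
      = (\<Sum>x\<in>F. \<Sum>y | y \<in> B \<and> adj G x y. weight G x y * (w y)\<^sup>2)"
    by (intro sum.cong) (auto simp: B_def nbrs_def)
  also have "\<dots> = (\<Sum>y\<in>B. \<Sum>x | x \<in> F \<and> adj G x y. weight G x y * (w y)\<^sup>2)"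
    using assms(3) fB by (rule sum.swap_restrict)
  also have "\<dots> \<le> (\<Sum>y\<in>B. C * (w y)\<^sup>2)"
  proof (rule sum_mono)
    fix y
    \<comment> \<open>After the exchange, symmetry of the weights makes the inner sum a part of the
      total weight at \<open>y\<close>.\<close>
    have "(\<Sum>x | x \<in> F \<and> adj G x y. weight G x y) = (\<Sum>x | x \<in> F \<and> adj G x y. weight G y x)"
      using weight_sym by (intro sum.cong) auto
    also have "\<dots> \<le> (\<Sum>x\<in>nbrs G y. weight G y x)"
      using locally_finite wt adj_sym by (intro sum_mono2) (auto simp: nbrs_def intro: less_imp_le)
    also have "\<dots> \<le> C"
      by (rule C)
    finally have "(\<Sum>x | x \<in> F \<and> adj G x y. weight G x y) * (w y)\<^sup>2 \<le> C * (w y)\<^sup>2"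
      by (intro mult_right_mono) auto
    then show "(\<Sum>x | x \<in> F \<and> adj G x y. weight G x y * (w y)\<^sup>2) \<le> C * (w y)\<^sup>2"
      by (simp add: sum_distrib_right)
  qed
  also have "\<dots> = C * (\<Sum>y\<in>B. (w y)\<^sup>2)"
    by (simp add: sum_distrib_left)
  also have "C * (\<Sum>x\<in>F. (w x)\<^sup>2) + C * (\<Sum>y\<in>B. (w y)\<^sup>2) \<le> C * (\<Sum>\<^sub>\<infinity>x. (w x)\<^sup>2) + C * (\<Sum>\<^sub>\<infinity>x. (w x)\<^sup>2)"
    using summ fB assms(2,3) by (intro add_mono mult_left_mono finite_sum_le_infsum) auto
  finally show ?thesis
    by simp
qed

text \<open>Summability is asserted along with the inequality, since \<open>integ\<close> of a
  non-summable family is 0 and the inequality alone would say little. \<open>K\<close> is uniform in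
  \<open>w\<close>.\<close>

lemma W22_integrand_bound:
  obtains K where "\<And>w. (\<lambda>x. vmeas G x * (w x)\<^sup>2) summable_on UNIV \<Longrightarrow>
      (\<lambda>x. vmeas G x * ((laplace G w x)\<^sup>2 + grad_sq G w x + (w x)\<^sup>2)) summable_on UNIV \<and>
      integ G UNIV (\<lambda>x. (laplace G w x)\<^sup>2 + grad_sq G w x + (w x)\<^sup>2) \<le> K * integ G UNIV (\<lambda>x. (w x)\<^sup>2)"
proof -
  obtain m where m: "m > 0" "\<And>x. m \<le> vmeas G x"
    using vmeas_bounded_below by auto
  obtain C' where C': "\<And>x. (\<Sum>y\<in>nbrs G x. weight G x y) < C'"
    using weight_bounded by auto
  define C where "C = max C' 0"
  have C: "(\<Sum>y\<in>nbrs G x. weight G x y) \<le> C" "C \<ge> 0" for x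
    using C' [of x] by (auto simp: C_def)
  \<comment> \<open>The Laplacian costs the factor \<open>2 * C / m\<close> against the gradient,
    the gradient costs \<open>2 * C\<close> against the sum of squares, and \<open>1 / m\<close>
    brings in the measure; the last 1 is the zeroth-order term.\<close>
  define K where "K = (2 * C / m + 1) * (2 * C) / m + 1"
  show ?thesis
  proof (rule that [of K], goal_cases)
    case (1 w)
    let ?f = "\<lambda>x. vmeas G x * ((laplace G w x)\<^sup>2 + grad_sq G w x + (w x)\<^sup>2)"
    have le: "(w x)\<^sup>2 \<le> vmeas G x * (w x)\<^sup>2 / m" for x
      using m(1) mult_right_mono [OF m(2) [of x], of "(w x)\<^sup>2"] by (simp add: field_simps)
    have summ': "(\<lambda>x. vmeas G x * (w x)\<^sup>2 / m) summable_on UNIV"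
      using summable_on_cmult_right [OF 1, of "1 / m"] by simp
    have summ: "(\<lambda>x. (w x)\<^sup>2) summable_on UNIV"
      by (rule summable_on_comparison_test [OF summ' le]) auto
    have "(\<Sum>\<^sub>\<infinity>x. (w x)\<^sup>2) \<le> (\<Sum>\<^sub>\<infinity>x. vmeas G x * (w x)\<^sup>2 / m)"
      by (rule infsum_mono [OF summ summ' le])
    also have "\<dots> = integ G UNIV (\<lambda>x. (w x)\<^sup>2) / m"
      using infsum_cmult_right' [of "1 / m" "\<lambda>x. vmeas G x * (w x)\<^sup>2" UNIV] by (simp add: integ_def)
    finally have ws: "(\<Sum>\<^sub>\<infinity>x. (w x)\<^sup>2) \<le> integ G UNIV (\<lambda>x. (w x)\<^sup>2) / m" .
    have f0: "?f x \<ge> 0" for x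
      using vmeas_pos [of x] grad_sq_nonneg [of w x] by auto
    have bound: "sum ?f F \<le> K * integ G UNIV (\<lambda>x. (w x)\<^sup>2)" if F: "finite F" for F
    proof -
      have "sum ?f F \<le> (\<Sum>x\<in>F. (2 * C / m + 1) * (vmeas G x * grad_sq G w x) + vmeas G x * (w x)\<^sup>2)"
      proof (rule sum_mono)
        fix x
        show "?f x \<le> (2 * C / m + 1) * (vmeas G x * grad_sq G w x) + vmeas G x * (w x)\<^sup>2"
          using mult_left_mono [OF laplace_sq_le_grad_sq [OF m(2,1) C(1), of w x], of "vmeas G x"] vmeas_pos [of x]
          by (simp add: algebra_simps)
      qed
      also have "\<dots> = (2 * C / m + 1) * (\<Sum>x\<in>F. vmeas G x * grad_sq G w x) + (\<Sum>x\<in>F. vmeas G x * (w x)\<^sup>2)"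
        by (simp add: sum.distrib sum_distrib_left)
      also have "\<dots> \<le> (2 * C / m + 1) * (2 * C * (integ G UNIV (\<lambda>x. (w x)\<^sup>2) / m)) + integ G UNIV (\<lambda>x. (w x)\<^sup>2)"
      proof (intro add_mono mult_left_mono)
        show "(\<Sum>x\<in>F. vmeas G x * grad_sq G w x) \<le> 2 * C * (integ G UNIV (\<lambda>x. (w x)\<^sup>2) / m)"
          using sum_grad_sq_le [OF C F summ] mult_left_mono [OF ws, of "2 * C"] C(2) by simp
        show "(\<Sum>x\<in>F. vmeas G x * (w x)\<^sup>2) \<le> integ G UNIV (\<lambda>x. (w x)\<^sup>2)"
          unfolding integ_def using 1 F vmeas_pos by (intro finite_sum_le_infsum) (auto intro: less_imp_le)
      qed (use m C in auto)
      finally show ?thesis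
        by (simp add: K_def algebra_simps)
    qed
    have sf: "?f summable_on UNIV"
      using f0 bound by (intro nonneg_bdd_above_summable_on bdd_aboveI2 [where M = "K * integ G UNIV (\<lambda>x. (w x)\<^sup>2)"]) auto
    then show ?case
      unfolding integ_def using infsum_le_finite_sums [OF sf] bound by (auto simp: integ_def)
  qed
qed

section \<open>Summability in the completions and on the Nehari manifold\<close>

text \<open>A Fatou argument: from an index \<open>M\<close> on, the Cauchy sequence stays within
  distance 1 of \<open>\<phi> M\<close>. Finite partial sums of the squared distance pass to the
  pointwise limit, and \<open>\<phi> M\<close> has finite support.\<close>

lemma W22_square_summable:
  assumes "u \<in> W22 G"
  shows "(\<lambda>x. vmeas G x * (u x)\<^sup>2) summable_on UNIV"
proof -
  obtain \<phi> where \<phi>: "\<And>n. \<phi> n \<in> Cc" "\<And>x. (\<lambda>n. \<phi> n x) \<longlonglongrightarrow> u x"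
    and cauchy: "\<And>e. e > 0 \<Longrightarrow> \<exists>M. \<forall>m\<ge>M. \<forall>n\<ge>M. norm_W22 G (\<lambda>x. \<phi> m x - \<phi> n x) < e"
    using assms unfolding W22_def fun_completion_def by auto
  obtain M where M: "\<And>n. n \<ge> M \<Longrightarrow> norm_W22 G (\<lambda>x. \<phi> n x - \<phi> M x) < 1"
    using cauchy [of 1] by auto
  obtain K where K: "\<And>w. (\<lambda>x. vmeas G x * (w x)\<^sup>2) summable_on UNIV \<Longrightarrow>
      (\<lambda>x. vmeas G x * ((laplace G w x)\<^sup>2 + grad_sq G w x + (w x)\<^sup>2)) summable_on UNIV \<and>
      integ G UNIV (\<lambda>x. (laplace G w x)\<^sup>2 + grad_sq G w x + (w x)\<^sup>2) \<le> K * integ G UNIV (\<lambda>x. (w x)\<^sup>2)"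
    using W22_integrand_bound by blast
  have Cc_summ: "(\<lambda>x. vmeas G x * (w x)\<^sup>2) summable_on UNIV" if "w \<in> Cc" for w
  proof -
    have "(\<lambda>x. vmeas G x * (w x)\<^sup>2) summable_on {x. w x \<noteq> 0}"
      using that by (simp add: Cc_def)
    moreover have "(\<lambda>x. vmeas G x * (w x)\<^sup>2) summable_on {x. w x \<noteq> 0}
        \<longleftrightarrow> (\<lambda>x. vmeas G x * (w x)\<^sup>2) summable_on UNIV"
      by (rule summable_on_cong_neutral) auto
    ultimately show ?thesis
      by simp
  qed
  have diff: "(\<Sum>x\<in>F. vmeas G x * (\<phi> n x - \<phi> M x)\<^sup>2) \<le> 1" if "finite F" "n \<ge> M" for F n
  proof -
    define w where "w = (\<lambda>x. \<phi> n x - \<phi> M x)"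
    have "{x. w x \<noteq> 0} \<subseteq> {x. \<phi> n x \<noteq> 0} \<union> {x. \<phi> M x \<noteq> 0}"
      by (auto simp: w_def)
    then have "w \<in> Cc"
      using \<phi>(1) [of n] \<phi>(1) [of M] by (auto simp: Cc_def intro: finite_subset)
    then have s: "(\<lambda>x. vmeas G x * ((laplace G w x)\<^sup>2 + grad_sq G w x + (w x)\<^sup>2)) summable_on UNIV"
      using K Cc_summ by blast
    have "(\<Sum>x\<in>F. vmeas G x * (w x)\<^sup>2) \<le> (\<Sum>x\<in>F. vmeas G x * ((laplace G w x)\<^sup>2 + grad_sq G w x + (w x)\<^sup>2))"
      using vmeas_pos grad_sq_nonneg by (intro sum_mono mult_left_mono) (auto intro: less_imp_le)
    also have "\<dots> \<le> integ G UNIV (\<lambda>x. (laplace G w x)\<^sup>2 + grad_sq G w x + (w x)\<^sup>2)"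
      unfolding integ_def using s that vmeas_pos grad_sq_nonneg
      by (intro finite_sum_le_infsum mult_nonneg_nonneg add_nonneg_nonneg) (auto intro: less_imp_le)
    also have "\<dots> \<le> 1"
      using M [OF that(2)] by (simp add: norm_W22_def w_def)
    finally show ?thesis
      by (simp add: w_def)
  qed
  have "(\<Sum>x\<in>F. vmeas G x * (u x - \<phi> M x)\<^sup>2) \<le> 1" if "finite F" for F
  proof (rule tendsto_upperbound)
    show "(\<lambda>n. \<Sum>x\<in>F. vmeas G x * (\<phi> n x - \<phi> M x)\<^sup>2) \<longlonglongrightarrow> (\<Sum>x\<in>F. vmeas G x * (u x - \<phi> M x)\<^sup>2)"
      by (intro tendsto_intros \<phi>)
    show "\<forall>\<^sub>F n in sequentially. (\<Sum>x\<in>F. vmeas G x * (\<phi> n x - \<phi> M x)\<^sup>2) \<le> 1"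
      using diff [OF that] by (auto simp: eventually_sequentially)
  qed simp
  then have "(\<lambda>x. vmeas G x * (u x - \<phi> M x)\<^sup>2) summable_on UNIV"
    using vmeas_pos by (intro nonneg_bdd_above_summable_on bdd_aboveI2 [where M = 1]) (auto intro: less_imp_le)
  then have "(\<lambda>x. 2 * (vmeas G x * (u x - \<phi> M x)\<^sup>2) + 2 * (vmeas G x * (\<phi> M x)\<^sup>2)) summable_on UNIV"
    using Cc_summ [OF \<phi>(1)] by (intro summable_on_add summable_on_cmult_right)
  then show ?thesis
  proof (rule summable_on_comparison_test)
    fix x
    \<comment> \<open>This square is exactly the difference of the two sides of the next
      inequality.\<close>
    have "0 \<le> (u x - 2 * \<phi> M x)\<^sup>2"
      by simp
    then have "(u x)\<^sup>2 \<le> 2 * (u x - \<phi> M x)\<^sup>2 + 2 * (\<phi> M x)\<^sup>2"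
      by (simp add: power2_eq_square algebra_simps)
    then show "vmeas G x * (u x)\<^sup>2 \<le> 2 * (vmeas G x * (u x - \<phi> M x)\<^sup>2) + 2 * (vmeas G x * (\<phi> M x)\<^sup>2)"
      using mult_left_mono [of "(u x)\<^sup>2" "2 * (u x - \<phi> M x)\<^sup>2 + 2 * (\<phi> M x)\<^sup>2" "vmeas G x"] vmeas_pos [of x]
      by (simp add: algebra_simps)
    show "0 \<le> vmeas G x * (u x)\<^sup>2"
      using vmeas_pos [of x] by simp
  qed
qed

text \<open>Guarantees that \<open>norm_E\<close> is computed from a genuine sum and not from the
  default value 0.\<close>

lemma E_space_summable:
  assumes "u \<in> E_space G a l"
  shows "(\<lambda>x. vmeas G x * ((laplace G u x)\<^sup>2 + grad_sq G u x + (l * a x + 1) * (u x)\<^sup>2)) summable_on UNIV"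
proof -
  have "(\<lambda>x. vmeas G x * ((laplace G u x)\<^sup>2 + grad_sq G u x + (u x)\<^sup>2)) summable_on UNIV"
    using W22_square_summable W22_integrand_bound assms by (metis (no_types, lifting) E_space_def mem_Collect_eq)
  moreover have "(\<lambda>x. vmeas G x * (l * a x * (u x)\<^sup>2)) summable_on UNIV"
    using assms by (simp add: E_space_def integ_finite_def)
  ultimately have "(\<lambda>x. vmeas G x * ((laplace G u x)\<^sup>2 + grad_sq G u x + (u x)\<^sup>2)
      + vmeas G x * (l * a x * (u x)\<^sup>2)) summable_on UNIV"
    by (rule summable_on_add)
  then show ?thesis
    by (simp add: algebra_simps)
qed

lemma norm_E_ge_sum:
  assumes "\<And>x. a x \<ge> 0" "l > 0" "u \<in> E_space G a l" "finite F"
  shows "(\<Sum>x\<in>F. vmeas G x * ((l * a x + 1) * (u x)\<^sup>2)) \<le> (norm_E G a l u)\<^sup>2"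
proof -
  have "(\<Sum>x\<in>F. vmeas G x * ((l * a x + 1) * (u x)\<^sup>2))
      \<le> (\<Sum>x\<in>F. vmeas G x * ((laplace G u x)\<^sup>2 + grad_sq G u x + (l * a x + 1) * (u x)\<^sup>2))"
    using vmeas_pos grad_sq_nonneg by (intro sum_mono mult_left_mono) (auto intro: less_imp_le)
  also have "\<dots> \<le> (norm_E G a l u)\<^sup>2"
    unfolding norm_E_squared [OF assms(1,2)] integ_def
    using E_space_summable [OF assms(3)] assms vmeas_pos grad_sq_nonneg
    by (intro finite_sum_le_infsum mult_nonneg_nonneg add_nonneg_nonneg) (auto intro: less_imp_le)
  finally show ?thesis .
qed

text \<open>If all values had modulus below 1, the power integrand would lie below the quadratic
  one, strictly where \<open>u\<close> is nonzero, against the equality of the integrals.\<close>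

lemma Nehari_exists_abs_ge_1:
  assumes a: "\<And>x. a x \<ge> 0" and "l > 0" "p > 2" and u: "u \<in> Nehari G a p l"
  shows "\<exists>x. \<bar>u x\<bar> \<ge> 1" and "(\<lambda>x. vmeas G x * \<bar>u x\<bar> powr p) summable_on UNIV"
proof -
  let ?f = "\<lambda>x. vmeas G x * ((laplace G u x)\<^sup>2 + grad_sq G u x + (l * a x + 1) * (u x)\<^sup>2)"
  let ?g = "\<lambda>x. vmeas G x * \<bar>u x\<bar> powr p"
  have E: "u \<in> E_space G a l"
    using u by (simp add: Nehari_def)
  obtain z where z: "u z \<noteq> 0"
    using u by (auto simp: Nehari_def)
  have eq: "infsum ?g UNIV = infsum ?f UNIV"
    using Nehari_norm_E(1) [OF a \<open>l > 0\<close> \<open>p > 2\<close> u] unfolding norm_E_squared [OF a \<open>l > 0\<close>] integ_def .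
  have "0 < vmeas G z * ((l * a z + 1) * (u z)\<^sup>2)"
    using vmeas_pos [of z] z a [of z] \<open>l > 0\<close> by (simp add: add_nonneg_pos)
  also have "\<dots> \<le> (norm_E G a l u)\<^sup>2"
    using norm_E_ge_sum [OF a \<open>l > 0\<close> E, of "{z}"] by simp
  \<comment> \<open>A non-summable family would have sum 0, so a nonzero value already implies
    summability.\<close>
  finally have "infsum ?g UNIV \<noteq> 0"
    unfolding eq norm_E_squared [OF a \<open>l > 0\<close>] integ_def by simp
  then show summ: "?g summable_on UNIV"
    using infsum_not_exists by blast
  show "\<exists>x. \<bar>u x\<bar> \<ge> 1"
  proof (rule ccontr)
    assume "\<not> ?thesis"
    then have small: "\<bar>u x\<bar> < 1" for x
      by (simp add: not_le)
    have sq: "(u x)\<^sup>2 \<le> (laplace G u x)\<^sup>2 + grad_sq G u x + (l * a x + 1) * (u x)\<^sup>2" for x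
      using grad_sq_nonneg [of u x] a [of x] \<open>l > 0\<close> by (simp add: distrib_right)
    have powr_le: "\<bar>u x\<bar> powr p \<le> (u x)\<^sup>2" for x
      using abs_powr_less_square [OF \<open>p > 2\<close> _ small [of x]] by (cases "u x = 0") auto
    \<comment> \<open>Nonnegative terms with nonpositive total vanish one by one, in particular at
      \<open>z\<close>.\<close>
    have "?f z - ?g z = 0"
    proof (rule nonneg_infsum_le_0D [of "\<lambda>x. ?f x - ?g x" UNIV])
      show "(\<lambda>x. ?f x - ?g x) summable_on UNIV"
        using summable_on_add [OF E_space_summable [OF E] summable_on_uminus [THEN iffD2, OF summ]] by simp
      show "(\<Sum>\<^sub>\<infinity>x. ?f x - ?g x) \<le> 0"
        using infsum_add [OF E_space_summable [OF E] summable_on_uminus [THEN iffD2, OF summ]] eq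
        by (simp add: infsum_uminus)
      show "?f x - ?g x \<ge> 0" for x
        using order_trans [OF powr_le [of x] sq [of x]] vmeas_pos [of x]
        by (simp add: mult_left_mono)
    qed simp
    moreover have "?g z < ?f z"
      using less_le_trans [OF abs_powr_less_square [OF \<open>p > 2\<close> z small] sq [of z]] vmeas_pos [of z]
      by simp
    ultimately show False
      by linarith
  qed
qed

end

section \<open>Compactness of the ground states and identification of the limit\<close>

theorem theorem1p3:
  fixes G :: "'v wgraph" and a :: "'v \<Rightarrow> real" and \<Omega> :: "'v set" and x0 :: 'v and p :: real
    and lam :: "nat \<Rightarrow> real" and u :: "nat \<Rightarrow> 'v \<Rightarrow> real"
  assumes "weighted_graph G"
    and "\<And>x. a x \<ge> 0"
    and "\<Omega> = {x. a x = 0}"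
    and "\<Omega> \<noteq> {}" and "connected_domain G \<Omega>" and "bounded_domain G \<Omega>"
    and "filterlim a at_top (filtercomap (\<lambda>x. gdist G x x0) at_top)"
    and "p > 2"
    and "\<And>k. lam k > 1"
    and "filterlim lam at_top sequentially"
    and "\<And>k. ground_state G a p (lam k) (u k)"
  shows "\<exists>r u0. strict_mono r \<and> u0 \<in> W22 G \<and>
           (\<lambda>k. norm_W22 G (\<lambda>x. u (r k) x - u0 x)) \<longlonglongrightarrow> 0 \<and>
           ground_state_dom G \<Omega> p u0"
proof -
  interpret weighted_graph G
    by fact
  have a: "\<And>x. a x \<ge> 0" and lam: "\<And>k. lam k > 0"
    using assms(2,9) by (auto intro: less_trans [of 0 1])
  have fin: "finite \<Omega>"
    by (rule finite_subset [OF _ finite_sublevel [OF assms(7), of 1]]) (use assms(3) in auto)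
  have a0: "\<And>x. x \<in> \<Omega> \<Longrightarrow> a x = 0"
    using assms(3) by simp
  obtain \<alpha> where \<alpha>: "\<alpha> > 0" "\<And>x. x \<notin> \<Omega> \<Longrightarrow> \<alpha> \<le> a x"
  proof
    have pos: "0 < a x" if "x \<notin> \<Omega>" for x
      using a [of x] that assms(3) by (simp add: order.strict_iff_order)
    \<comment> \<open>Only finitely many vertices have \<open>a x < 1\<close>; the inserted 1 covers
      all others and keeps the set nonempty.\<close>
    let ?S = "insert 1 (a ` ({x. a x < 1} - \<Omega>))"
    have fS: "finite ?S"
      using finite_sublevel [OF assms(7), of 1] by auto
    show "Min ?S > 0"
      unfolding Min_gr_iff [OF fS insert_not_empty] using pos by auto
    show "Min ?S \<le> a x" if "x \<notin> \<Omega>" for x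
    proof (cases "a x < 1")
      case True
      then show ?thesis
        using fS that by (intro Min_le) auto
    next
      case False
      then show ?thesis
        using Min_le [OF fS, of 1] by simp
    qed
  qed
  obtain m where m: "m > 0" "\<And>x. m \<le> vmeas G x"
    using vmeas_bounded_below by auto
  define c where "c = 1 / 2 - 1 / p"
  have c: "c > 0"
    using assms(8) by (simp add: c_def field_simps)
  have N: "u k \<in> Nehari G a p (lam k)" for k
    using assms(11) by (simp add: ground_state_def)
  then have E: "u k \<in> E_space G a (lam k)" for k
    by (simp add: Nehari_def)

  \<comment> \<open>Since \<open>a\<close> vanishes on \<open>\<Omega>\<close>, competitors on \<open>\<Omega>\<close> are competitors on \<open>V\<close> for every \<open>\<lambda>\<close>.\<close>
  have J_le: "c * (norm_E G a (lam k) (u k))\<^sup>2 \<le> J_dom G \<Omega> p v" if v: "v \<in> Nehari_dom G \<Omega> p" for k v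
  proof -
    have "J G a p (lam k) w \<ge> 0" if "w \<in> Nehari G a p (lam k)" for w
      using Nehari_norm_E(2) [OF a lam assms(8) that] c by (simp add: c_def)
    then have "bdd_below (J G a p (lam k) ` Nehari G a p (lam k))"
      by (intro bdd_belowI2)
    then have "ground_level G a p (lam k) \<le> J G a p (lam k) v"
      unfolding ground_level_def using v Nehari_dom_subset_Nehari [of \<Omega> a p "lam k", OF fin a0]
      by (intro cINF_lower) auto
    also have "\<dots> = J_dom G \<Omega> p v"
      using v H_dom_eq [OF fin] by (intro J_eq_J_dom fin a0 a lam) (auto simp: Nehari_dom_def)
    finally show ?thesis
      using assms(11) [of k] Nehari_norm_E(2) [OF a lam assms(8) N] by (simp add: ground_state_def c_def)
  qed
  \<comment> \<open>One fixed competitor on \<Omega> gives a bound \<open>B\<close> independent of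
    \<open>k\<close>.\<close>
  obtain v0 where "v0 \<in> Nehari_dom G \<Omega> p"
    using Nehari_dom_nonempty [OF fin assms(4,8)] by auto
  then obtain B where B: "(norm_E G a (lam k) (u k))\<^sup>2 \<le> B" for k
    using J_le c by (metis mult.commute pos_le_divide_eq)
  have sum_le_B: "(\<Sum>x\<in>F. vmeas G x * ((lam k * a x + 1) * (u k x)\<^sup>2)) \<le> B" if "finite F" for F k
    using norm_E_ge_sum [OF a lam E that] B order_trans by blast
  have B0: "B \<ge> 0"
    using B [of 0] zero_le_power2 order_trans by blast
  \<comment> \<open>Off \<Omega> the factor \<open>lam k * a x + 1\<close> is at least
    \<open>lam k * \<alpha>\<close>, which turns the bound \<open>B\<close> into decay of the
    mass.\<close>
  have sum_sq_le: "(\<Sum>x\<in>F. vmeas G x * (u k x)\<^sup>2) \<le> B / (lam k * \<alpha>)" if "finite F" "F \<inter> \<Omega> = {}" for F k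
  proof -
    have "(\<Sum>x\<in>F. lam k * \<alpha> * (vmeas G x * (u k x)\<^sup>2)) \<le> (\<Sum>x\<in>F. vmeas G x * ((lam k * a x + 1) * (u k x)\<^sup>2))"
    proof (rule sum_mono)
      fix x assume "x \<in> F"
      then have "lam k * \<alpha> \<le> lam k * a x + 1"
        using \<alpha>(2) [of x] lam [of k] that(2) by (intro order_trans [OF mult_left_mono [of \<alpha> "a x"]]) auto
      then have "lam k * \<alpha> * (vmeas G x * (u k x)\<^sup>2) \<le> (lam k * a x + 1) * (vmeas G x * (u k x)\<^sup>2)"
        using vmeas_pos [of x] by (intro mult_right_mono) auto
      then show "lam k * \<alpha> * (vmeas G x * (u k x)\<^sup>2) \<le> vmeas G x * ((lam k * a x + 1) * (u k x)\<^sup>2)"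
        by (simp add: algebra_simps)
    qed
    then have "lam k * \<alpha> * (\<Sum>x\<in>F. vmeas G x * (u k x)\<^sup>2) \<le> B"
      using sum_le_B [OF that(1), of k] by (simp add: sum_distrib_left)
    then show ?thesis
      using lam [of k] \<alpha>(1) by (simp add: field_simps)
  qed
  have bounded: "norm (u k x) \<le> sqrt (B / m)" for k x
  proof -
    have "m * (u k x)\<^sup>2 \<le> vmeas G x * ((lam k * a x + 1) * (u k x)\<^sup>2)"
      using m vmeas_pos [of x] a [of x] lam [of k]
      by (intro mult_mono) (auto simp: distrib_right intro: less_imp_le)
    also have "\<dots> \<le> B"
      using sum_le_B [of "{x}" k] by simp
    finally show ?thesis
      using m by (intro real_le_rsqrt) (simp add: field_simps)
  qed
  obtain r where r: "strict_mono r" "\<And>x. x \<in> \<Omega> \<Longrightarrow> \<exists>l. (\<lambda>n. u (r n) x) \<longlonglongrightarrow> l"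
  proof (rule function_convergent_subsequence [OF countable_finite [OF fin]])
    show "norm (u k x) \<le> sqrt (B / m)" for k x
      by (rule bounded)
  qed (rule that)
  \<comment> \<open>Off \<Omega> the value 0 is forced by the vanishing mass there.\<close>
  define u0 where "u0 = (\<lambda>x. if x \<in> \<Omega> then lim (\<lambda>n. u (r n) x) else 0)"
  have supp: "{x. u0 x \<noteq> 0} \<subseteq> \<Omega>"
    by (auto simp: u0_def)
  then have H: "u0 \<in> H_dom G \<Omega>" and W: "u0 \<in> W22 G"
    using H_dom_eq [OF fin] Cc_subset_W22 finite_subset [OF supp fin] by (auto simp: Cc_def)
  have lim_\<Omega>: "(\<lambda>n. u (r n) x) \<longlonglongrightarrow> u0 x" if "x \<in> \<Omega>" for x
    using r(2) [OF that] that by (auto simp: u0_def limI)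
  have decay: "(\<lambda>n. B / (lam (r n) * \<alpha>)) \<longlonglongrightarrow> 0"
  proof -
    have "filterlim (\<lambda>n. lam (r n)) at_top sequentially"
      using assms(10) filterlim_subseq [OF r(1)] by (rule filterlim_compose)
    then have "filterlim (\<lambda>n. lam (r n) * \<alpha>) at_infinity sequentially"
      using \<alpha>(1) by (intro filterlim_at_top_imp_at_infinity filterlim_at_top_mult_tendsto_pos [where c = \<alpha>]) 
        (auto simp: mult.commute)
    then show ?thesis
      by (intro tendsto_divide_0 [OF tendsto_const])
  qed

  \<comment> \<open>The first part measures the distance on the finite set \<Omega>, the second the
    mass off \<Omega>, where \<open>u0\<close> is zero.\<close>
  define \<epsilon> where "\<epsilon> = (\<lambda>n. (\<Sum>x\<in>\<Omega>. vmeas G x * (u (r n) x - u0 x)\<^sup>2) + B / (lam (r n) * \<alpha>))"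
  have "\<epsilon> \<longlonglongrightarrow> (\<Sum>x\<in>\<Omega>. vmeas G x * (u0 x - u0 x)\<^sup>2) + 0"
    unfolding \<epsilon>_def by (intro tendsto_intros decay lim_\<Omega>)
  then have \<epsilon>: "\<epsilon> \<longlonglongrightarrow> 0"
    by simp
  have diff_le: "(\<Sum>x\<in>F. vmeas G x * (u (r n) x - u0 x)\<^sup>2) \<le> \<epsilon> n" if "finite F" for F n
  proof -
    have "(\<Sum>x\<in>F. vmeas G x * (u (r n) x - u0 x)\<^sup>2)
        = (\<Sum>x\<in>F \<inter> \<Omega>. vmeas G x * (u (r n) x - u0 x)\<^sup>2) + (\<Sum>x\<in>F - \<Omega>. vmeas G x * (u (r n) x - u0 x)\<^sup>2)"
      using that by (simp add: sum.Int_Diff)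
    also have "(\<Sum>x\<in>F - \<Omega>. vmeas G x * (u (r n) x - u0 x)\<^sup>2) = (\<Sum>x\<in>F - \<Omega>. vmeas G x * (u (r n) x)\<^sup>2)"
      by (intro sum.cong) (auto simp: u0_def)
    also have "\<dots> \<le> B / (lam (r n) * \<alpha>)"
      using that by (intro sum_sq_le) auto
    also have "(\<Sum>x\<in>F \<inter> \<Omega>. vmeas G x * (u (r n) x - u0 x)\<^sup>2) \<le> (\<Sum>x\<in>\<Omega>. vmeas G x * (u (r n) x - u0 x)\<^sup>2)"
      using fin vmeas_pos by (intro sum_mono2) (auto intro: less_imp_le)
    finally show ?thesis
      by (simp add: \<epsilon>_def)
  qed
  \<comment> \<open>Convergence off \<Omega> matters too: the operators on \<Omega> and its boundary
    see values at neighbours outside \<Omega>.\<close>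
  have lim: "(\<lambda>n. u (r n) x) \<longlonglongrightarrow> u0 x" for x
  proof -
    have lim0: "(\<lambda>n. sqrt (\<epsilon> n / vmeas G x)) \<longlonglongrightarrow> sqrt (0 / vmeas G x)"
      using vmeas_pos [of x] by (intro tendsto_intros \<epsilon>) auto
    have le: "norm (u (r n) x - u0 x) \<le> sqrt (\<epsilon> n / vmeas G x)" for n
      using diff_le [of "{x}" n] vmeas_pos [of x] by (intro real_le_rsqrt) (simp add: field_simps)
    have "(\<lambda>n. u (r n) x - u0 x) \<longlonglongrightarrow> 0"
      by (rule Lim_null_comparison [OF always_eventually [OF allI [OF le]]]) (use lim0 in simp)
    then show ?thesis
      by (rule LIM_zero_cancel)
  qed

  have conv: "(\<lambda>k. norm_W22 G (\<lambda>x. u (r k) x - u0 x)) \<longlonglongrightarrow> 0"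
  proof -
    obtain K where K: "\<And>w. (\<lambda>x. vmeas G x * (w x)\<^sup>2) summable_on UNIV \<Longrightarrow>
        (\<lambda>x. vmeas G x * ((laplace G w x)\<^sup>2 + grad_sq G w x + (w x)\<^sup>2)) summable_on UNIV \<and>
        integ G UNIV (\<lambda>x. (laplace G w x)\<^sup>2 + grad_sq G w x + (w x)\<^sup>2) \<le> K * integ G UNIV (\<lambda>x. (w x)\<^sup>2)"
      using W22_integrand_bound by blast
    have le: "norm_W22 G (\<lambda>x. u (r n) x - u0 x) \<le> sqrt (\<bar>K\<bar> * \<epsilon> n)" for n
    proof -
      have s: "(\<lambda>x. vmeas G x * (u (r n) x - u0 x)\<^sup>2) summable_on UNIV"
        using diff_le [of _ n] vmeas_pos
        by (intro nonneg_bdd_above_summable_on bdd_aboveI2 [where M = "\<epsilon> n"]) (auto intro: less_imp_le)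
      have i: "integ G UNIV (\<lambda>x. (u (r n) x - u0 x)\<^sup>2) \<le> \<epsilon> n"
        unfolding integ_def by (rule infsum_le_finite_sums [OF s diff_le])
      have i0: "0 \<le> integ G UNIV (\<lambda>x. (u (r n) x - u0 x)\<^sup>2)"
        unfolding integ_def using vmeas_pos by (intro infsum_nonneg) (auto intro: less_imp_le)
      have "K * integ G UNIV (\<lambda>x. (u (r n) x - u0 x)\<^sup>2) \<le> \<bar>K\<bar> * \<epsilon> n"
        using i i0 by (intro mult_mono) auto
      then show ?thesis
        unfolding norm_W22_def using K [OF s] by (intro real_sqrt_le_mono) linarith
    qed
    have "norm_W22 G (\<lambda>x. u (r n) x - u0 x) \<ge> 0" for n
      unfolding norm_W22_def integ_def using grad_sq_nonneg
      by (intro real_sqrt_ge_zero infsum_nonneg mult_nonneg_nonneg add_nonneg_nonneg) auto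
    then have norm_le: "norm (norm_W22 G (\<lambda>x. u (r n) x - u0 x)) \<le> sqrt (\<bar>K\<bar> * \<epsilon> n)" for n
      using le [of n] by simp
    have "(\<lambda>n. sqrt (\<bar>K\<bar> * \<epsilon> n)) \<longlonglongrightarrow> sqrt (\<bar>K\<bar> * 0)"
      by (intro tendsto_intros \<epsilon>)
    then show ?thesis
      by (intro Lim_null_comparison [OF always_eventually [OF allI [OF norm_le]]]) simp
  qed

  have critical: "dJ_dom G \<Omega> p u0 \<phi> = 0" if \<phi>: "\<phi> \<in> H_dom G \<Omega>" for \<phi>
  proof -
    have supp\<phi>: "{x. \<phi> x \<noteq> 0} \<subseteq> \<Omega>"
      using \<phi> H_dom_eq [OF fin] by auto
    then have "\<phi> \<in> E_space G a l" for l
      by (intro supported_in_E_space [of \<Omega> a] fin a0)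
    then have "dJ_dom G \<Omega> p (u (r n)) \<phi> = 0" for n
      using assms(11) dJ_eq_dJ_dom [of \<Omega> a \<phi>, OF fin a0 supp\<phi>] by (metis ground_state_def)
    moreover have "(\<lambda>n. dJ_dom G \<Omega> p (u (r n)) \<phi>) \<longlonglongrightarrow> dJ_dom G \<Omega> p u0 \<phi>"
    proof -
      have finU: "finite (\<Omega> \<union> bdry G \<Omega>)"
        using fin finite_bdry by simp
      show ?thesis
        \<comment> \<open>All sums are finite, and the power with exponent p - 2 > 0 is continuous
          also at 0, so zeros of \<open>u0\<close> do no harm.\<close>
        unfolding dJ_dom_def integ_finite_sum [OF finU] integ_finite_sum [OF fin] laplace_def grad_dot_def
        using vmeas_pos assms(8) by (intro tendsto_intros lim) (auto simp: less_imp_neq [symmetric])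
    qed
    ultimately show ?thesis
      by (simp add: LIMSEQ_const_iff)
  qed

  have "u0 \<noteq> (\<lambda>_. 0)"
  proof
    assume "u0 = (\<lambda>_. 0)"
    then have "\<forall>\<^sub>F n in sequentially. \<epsilon> n < m"
      using \<epsilon> m(1) by (simp add: order_tendsto_iff)
    then obtain n where n: "\<epsilon> n < m"
      by (auto simp: eventually_sequentially)
    \<comment> \<open>The vertex may change with \<open>n\<close>, but \<open>\<epsilon> n\<close>
      bounds the squared distance at all vertices at once, and a value of modulus at least 1 has
      mass at least \<open>m\<close>.\<close>
    obtain x where x: "\<bar>u (r n) x\<bar> \<ge> 1"
      using Nehari_exists_abs_ge_1(1) [OF a lam assms(8) N] by blast
    then have "1 \<le> (u (r n) x)\<^sup>2"
      using one_le_power [of "\<bar>u (r n) x\<bar>" 2] by simp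
    then have "m * 1 \<le> vmeas G x * (u (r n) x)\<^sup>2"
      using m by (intro mult_mono) auto
    also have "\<dots> \<le> \<epsilon> n"
      using diff_le [of "{x}" n] \<open>u0 = (\<lambda>_. 0)\<close> by simp
    finally show False
      using n by simp
  qed
  then have N0: "u0 \<in> Nehari_dom G \<Omega> p"
    using H critical by (simp add: Nehari_dom_def)

  \<comment> \<open>The energy of \<open>u0\<close> is the limit of \<open>c\<close> times the power
    sums of \<open>u (r n)\<close> over \<Omega>. These are at most \<open>c\<close> times the full
    power integrals, that is the ground levels on V, which lie below the energy of every competitor
    \<open>v\<close>.\<close>
  have "J_dom G \<Omega> p u0 \<le> J_dom G \<Omega> p v" if v: "v \<in> Nehari_dom G \<Omega> p" for v
  proof (rule tendsto_upperbound)
    show "(\<lambda>n. c * (\<Sum>x\<in>\<Omega>. vmeas G x * \<bar>u (r n) x\<bar> powr p)) \<longlonglongrightarrow> J_dom G \<Omega> p u0"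
      unfolding Nehari_dom_J_dom [OF fin assms(8) N0] c_def [symmetric] integ_finite_sum [OF fin]
      using assms(8) by (intro tendsto_intros lim) auto
    have "c * (\<Sum>x\<in>\<Omega>. vmeas G x * \<bar>u k x\<bar> powr p) \<le> J_dom G \<Omega> p v" for k
    proof -
      have "(\<Sum>x\<in>\<Omega>. vmeas G x * \<bar>u k x\<bar> powr p) \<le> integ G UNIV (\<lambda>x. \<bar>u k x\<bar> powr p)"
        unfolding integ_def using Nehari_exists_abs_ge_1(2) [OF a lam assms(8) N] fin vmeas_pos
        by (intro finite_sum_le_infsum) (auto intro: less_imp_le)
      also have "\<dots> = (norm_E G a (lam k) (u k))\<^sup>2"
        by (rule Nehari_norm_E(1) [OF a lam assms(8) N])
      finally show ?thesis
        using J_le [OF v, of k] c by (meson less_imp_le mult_left_mono order_trans)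
    qed
    then show "\<forall>\<^sub>F n in sequentially. c * (\<Sum>x\<in>\<Omega>. vmeas G x * \<bar>u (r n) x\<bar> powr p) \<le> J_dom G \<Omega> p v"
      by simp
  qed simp
  then have "J_dom G \<Omega> p u0 = ground_level_dom G \<Omega> p"
    unfolding ground_level_dom_def using N0
    by (intro antisym cINF_greatest cINF_lower bdd_belowI2 [where m = "J_dom G \<Omega> p u0"]) auto
  then have "ground_state_dom G \<Omega> p u0"
    using N0 critical by (simp add: ground_state_dom_def)
  then show ?thesis
    using r(1) W conv by blast
qed

end
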